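(* Constancy atoms are not safe for $\mathrm{FO}(\subseteq_1)$: there exists a sentence of $\mathrm{FO}(=\!\!(\cdot),\subseteq_1)$ that is not equivalent to any sentence of $\mathrm{FO}(\subseteq_1)$.
   Context: All models $\mathfrak M$ are first order models whose domain $M$ has at least two elements. A team $X$ over $\mathfrak M$ with (finite) domain $V=\mathrm{Dom}(X)$ is a set (possibly empty) of assignments $s:V\to M$. For a tuple $\mathbf t$ of terms with variables in $V$, $X(\mathbf t)=\{s(\mathbf t): s\in X\}$. For a variable $v$: $X[H/v]=\{s[m/v]: s\in X, m\in H(s)\}$ for $H:X\to\mathcal P(M)\setminus\{\emptyset\}$, and $X[M/v]=\{s[m/v]: s\in X, m\in M\}$. A $k$-ary first order dependency $\mathbf D$ is a first order sentence $\mathbf D(R)$ over the signature $\{R\}$, with $R$ a $k$-ary relation symbol. For a set $\mathcal D$ of dependencies, $\mathrm{FO}(\mathcal D)$ is the set of formulas (in negation normal form, over arbitrary signatures) built from first order literals and dependency atoms $\mathbf D\mathbf t$ ($\mathbf D\in\mathcal D$, $\mathbf t$ a tuple of terms of the same length as the arity of $\mathbf D$) by $\vee,\wedge,\exists v,\forall v$; dependency atoms are not negated. $\mathrm{FO}(\mathcal E,\mathcal D)$ means $\mathrm{FO}(\mathcal E\cup\mathcal D)$. Satisfaction $\mathfrak M\models_X\phi$ (for $\mathrm{Dom}(X)$ containing the free variables of $\phi$) is given by: - literal $\alpha$: $\mathfrak M\models_X\alpha$ iff every $s\in X$ satisfies $\alpha$ in the usual Tarskian sense; - $\mathfrak M\models_X\mathbf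 D\mathbf t$ iff the structure $(M, X(\mathbf t))$ satisfies $\mathbf D(R)$ (Tarskian) with $R$ interpreted as $X(\mathbf t)$; - $\mathfrak M\models_X\psi_1\vee\psi_2$ iff $X=Y\cup Z$ for some teams $Y,Z$ with $\mathfrak M\models_Y\psi_1$ and $\mathfrak M\models_Z\psi_2$; - $\mathfrak M\models_X\psi_1\wedge\psi_2$ iff $\mathfrak M\models_X\psi_1$ and $\mathfrak M\models_X\psi_2$; - $\mathfrak M\models_X\exists v\psi$ iff $\mathfrak M\models_{X[H/v]}\psi$ for some $H:X\to\mathcal P(M)\setminus\{\emptyset\}$; - $\mathfrak M\models_X\forall v\psi$ iff $\mathfrak M\models_{X[M/v]}\psi$. A sentence $\phi$ is true in $\mathfrak M$ ($\mathfrak M\models\phi$) iff $\mathfrak M\models_{\{\epsilon\}}\phi$, where $\epsilon$ is the empty assignment. Two sentences over the same signature are equivalent if they are true in the same models. A set of dependencies $\mathcal E$ is safe for $\mathcal D$ if every sentence of $\mathrm{FO}(\mathcal E,\mathcal D)$ is equivalent to some sentence of $\mathrm{FO}(\mathcal D)$. The constancy dependency is $=\!\!(\cdot):=\forall vw(Uv\wedge Uw\to v=w)$ with $U$ unary, so $\mathfrak M\models_X =\!\!(x)$ iff $x$ takes at most one value in $X$. The unary inclusion dependency $\subseteq_1$ is $\forall uv(Ruv\to\exists w\,Rwu)$ with $R$ binary; its atom applied to the pair $xy$ is written $x\subseteq y$, and $\mathfrak M\models_X x\subseteq y$ iff $X(x)\subseteq X(y)$. *)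

theory Defs
  imports Main
begin

section \<open>First order syntax and Tarskian semantics\<close>

datatype tm = Var nat | Fun nat "tm list"

datatype atom = Eq tm tm | Rel nat "tm list"

datatype fo =
    FAtom atom
  | FNot fo
  | FAnd fo fo
  | FOr fo fo
  | FImp fo fo
  | FEx nat fo
  | FAll nat fo

text \<open>A signature maps its function and relation symbols to their arities; constants are
  function symbols of arity 0.\<close>

record signature =
  fn_ar :: "nat \<Rightarrow> nat option"
  rel_ar :: "nat \<Rightarrow> nat option"

primrec tm_over :: "signature \<Rightarrow> tm \<Rightarrow> bool" where
  "tm_over \<sigma> (Var v) \<longleftrightarrow> True"
| "tm_over \<sigma> (Fun f ts) \<longleftrightarrow> fn_ar \<sigma> f = Some (length ts) \<and> list_all (tm_over \<sigma>) ts"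

primrec tm_vars :: "tm \<Rightarrow> nat set" where
  "tm_vars (Var v) = {v}"
| "tm_vars (Fun f ts) = \<Union> (set (map tm_vars ts))"

primrec atom_over :: "signature \<Rightarrow> atom \<Rightarrow> bool" where
  "atom_over \<sigma> (Eq t u) \<longleftrightarrow> tm_over \<sigma> t \<and> tm_over \<sigma> u"
| "atom_over \<sigma> (Rel r ts) \<longleftrightarrow> rel_ar \<sigma> r = Some (length ts) \<and> list_all (tm_over \<sigma>) ts"

primrec atom_vars :: "atom \<Rightarrow> nat set" where
  "atom_vars (Eq t u) = tm_vars t \<union> tm_vars u"
| "atom_vars (Rel r ts) = \<Union> (set (map tm_vars ts))"

primrec fo_over :: "signature \<Rightarrow> fo \<Rightarrow> bool" where
  "fo_over \<sigma> (FAtom a) \<longleftrightarrow> atom_over \<sigma> a"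
| "fo_over \<sigma> (FNot \<phi>) \<longleftrightarrow> fo_over \<sigma> \<phi>"
| "fo_over \<sigma> (FAnd \<phi> \<psi>) \<longleftrightarrow> fo_over \<sigma> \<phi> \<and> fo_over \<sigma> \<psi>"
| "fo_over \<sigma> (FOr \<phi> \<psi>) \<longleftrightarrow> fo_over \<sigma> \<phi> \<and> fo_over \<sigma> \<psi>"
| "fo_over \<sigma> (FImp \<phi> \<psi>) \<longleftrightarrow> fo_over \<sigma> \<phi> \<and> fo_over \<sigma> \<psi>"
| "fo_over \<sigma> (FEx v \<phi>) \<longleftrightarrow> fo_over \<sigma> \<phi>"
| "fo_over \<sigma> (FAll v \<phi>) \<longleftrightarrow> fo_over \<sigma> \<phi>"

primrec fo_free :: "fo \<Rightarrow> nat set" where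
  "fo_free (FAtom a) = atom_vars a"
| "fo_free (FNot \<phi>) = fo_free \<phi>"
| "fo_free (FAnd \<phi> \<psi>) = fo_free \<phi> \<union> fo_free \<psi>"
| "fo_free (FOr \<phi> \<psi>) = fo_free \<phi> \<union> fo_free \<psi>"
| "fo_free (FImp \<phi> \<psi>) = fo_free \<phi> \<union> fo_free \<psi>"
| "fo_free (FEx v \<phi>) = fo_free \<phi> - {v}"
| "fo_free (FAll v \<phi>) = fo_free \<phi> - {v}"

record 'm model =
  univ :: "'m set"
  fn :: "nat \<Rightarrow> 'm list \<Rightarrow> 'm"
  rel :: "nat \<Rightarrow> 'm list set"

text \<open>The interpretation of symbols outside of the signature is irrelevant junk.\<close>

definition is_model :: "signature \<Rightarrow> 'm model \<Rightarrow> bool" where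
  "is_model \<sigma> \<MM> \<longleftrightarrow>
     (\<exists>a\<in>univ \<MM>. \<exists>b\<in>univ \<MM>. a \<noteq> b) \<and>
     (\<forall>f k xs. fn_ar \<sigma> f = Some k \<longrightarrow> length xs = k \<longrightarrow> set xs \<subseteq> univ \<MM> \<longrightarrow> fn \<MM> f xs \<in> univ \<MM>) \<and>
     (\<forall>r k. rel_ar \<sigma> r = Some k \<longrightarrow> rel \<MM> r \<subseteq> {xs. length xs = k \<and> set xs \<subseteq> univ \<MM>})"

text \<open>Assignments are partial maps, so that the domain of an assignment is explicit and the
  empty assignment is \<^term>\<open>Map.empty\<close>. Values at variables outside of the domain are never
  accessed when the domain contains the free variables.\<close>

type_synonym 'm assignment = "nat \<Rightarrow> 'm option"

primrec tm_val :: "'m model \<Rightarrow> 'm assignment \<Rightarrow> tm \<Rightarrow> 'm" where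
  "tm_val \<MM> s (Var v) = the (s v)"
| "tm_val \<MM> s (Fun f ts) = fn \<MM> f (map (tm_val \<MM> s) ts)"

primrec atom_sat :: "'m model \<Rightarrow> 'm assignment \<Rightarrow> atom \<Rightarrow> bool" where
  "atom_sat \<MM> s (Eq t u) \<longleftrightarrow> tm_val \<MM> s t = tm_val \<MM> s u"
| "atom_sat \<MM> s (Rel r ts) \<longleftrightarrow> map (tm_val \<MM> s) ts \<in> rel \<MM> r"

primrec fo_sat :: "'m model \<Rightarrow> 'm assignment \<Rightarrow> fo \<Rightarrow> bool" where
  "fo_sat \<MM> s (FAtom a) \<longleftrightarrow> atom_sat \<MM> s a"
| "fo_sat \<MM> s (FNot \<phi>) \<longleftrightarrow> \<not> fo_sat \<MM> s \<phi>"
| "fo_sat \<MM> s (FAnd \<phi> \<psi>) \<longleftrightarrow> fo_sat \<MM> s \<phi> \<and> fo_sat \<MM> s \<psi>"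
| "fo_sat \<MM> s (FOr \<phi> \<psi>) \<longleftrightarrow> fo_sat \<MM> s \<phi> \<or> fo_sat \<MM> s \<psi>"
| "fo_sat \<MM> s (FImp \<phi> \<psi>) \<longleftrightarrow> (fo_sat \<MM> s \<phi> \<longrightarrow> fo_sat \<MM> s \<psi>)"
| "fo_sat \<MM> s (FEx v \<phi>) \<longleftrightarrow> (\<exists>m\<in>univ \<MM>. fo_sat \<MM> (s(v \<mapsto> m)) \<phi>)"
| "fo_sat \<MM> s (FAll v \<phi>) \<longleftrightarrow> (\<forall>m\<in>univ \<MM>. fo_sat \<MM> (s(v \<mapsto> m)) \<phi>)"


section \<open>Dependencies\<close>

text \<open>A dependency is an arity \<open>k\<close> together with a sentence in a single \<open>k\<close>-ary relation
  symbol, for which the symbol 0 is used throughout.\<close>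

datatype dependency = Dependency (dep_arity: nat) (dep_body: fo)

definition is_dependency :: "dependency \<Rightarrow> bool" where
  "is_dependency D \<longleftrightarrow>
     fo_over \<lparr>fn_ar = Map.empty, rel_ar = [0 \<mapsto> dep_arity D]\<rparr> (dep_body D) \<and>
     fo_free (dep_body D) = {}"

definition dep_holds :: "'m set \<Rightarrow> dependency \<Rightarrow> 'm list set \<Rightarrow> bool" where
  "dep_holds M D R \<longleftrightarrow>
     fo_sat \<lparr>univ = M, fn = undefined, rel = (\<lambda>_. {})(0 := R)\<rparr> Map.empty (dep_body D)"

definition constancy :: dependency where
  "constancy = Dependency 1
     (FAll 0 (FAll 1 (FImp (FAnd (FAtom (Rel 0 [Var 0])) (FAtom (Rel 0 [Var 1])))
                           (FAtom (Eq (Var 0) (Var 1))))))"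

definition unary_inclusion :: dependency where
  "unary_inclusion = Dependency 2
     (FAll 0 (FAll 1 (FImp (FAtom (Rel 0 [Var 0, Var 1]))
                           (FEx 2 (FAtom (Rel 0 [Var 2, Var 0]))))))"


section \<open>Team semantics\<close>

datatype form =
    Pos atom
  | Neg atom
  | Dep dependency "tm list"
  | Or form form
  | And form form
  | Exi nat form
  | Uni nat form

primrec form_free :: "form \<Rightarrow> nat set" where
  "form_free (Pos a) = atom_vars a"
| "form_free (Neg a) = atom_vars a"
| "form_free (Dep D ts) = \<Union> (set (map tm_vars ts))"
| "form_free (Or \<phi> \<psi>) = form_free \<phi> \<union> form_free \<psi>"
| "form_free (And \<phi> \<psi>) = form_free \<phi> \<union> form_free \<psi>"
| "form_free (Exi v \<phi>) = form_free \<phi> - {v}"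
| "form_free (Uni v \<phi>) = form_free \<phi> - {v}"

text \<open>\<open>in_FO \<D> \<sigma> \<phi>\<close>: \<open>\<phi>\<close> is a formula of \<open>FO(\<D>)\<close> over the signature \<open>\<sigma>\<close>.\<close>

primrec in_FO :: "dependency set \<Rightarrow> signature \<Rightarrow> form \<Rightarrow> bool" where
  "in_FO \<D> \<sigma> (Pos a) \<longleftrightarrow> atom_over \<sigma> a"
| "in_FO \<D> \<sigma> (Neg a) \<longleftrightarrow> atom_over \<sigma> a"
| "in_FO \<D> \<sigma> (Dep D ts) \<longleftrightarrow> D \<in> \<D> \<and> length ts = dep_arity D \<and> list_all (tm_over \<sigma>) ts"
| "in_FO \<D> \<sigma> (Or \<phi> \<psi>) \<longleftrightarrow> in_FO \<D> \<sigma> \<phi> \<and> in_FO \<D> \<sigma> \<psi>"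
| "in_FO \<D> \<sigma> (And \<phi> \<psi>) \<longleftrightarrow> in_FO \<D> \<sigma> \<phi> \<and> in_FO \<D> \<sigma> \<psi>"
| "in_FO \<D> \<sigma> (Exi v \<phi>) \<longleftrightarrow> in_FO \<D> \<sigma> \<phi>"
| "in_FO \<D> \<sigma> (Uni v \<phi>) \<longleftrightarrow> in_FO \<D> \<sigma> \<phi>"

definition FO_sentences :: "dependency set \<Rightarrow> signature \<Rightarrow> form set" where
  "FO_sentences \<D> \<sigma> = {\<phi>. in_FO \<D> \<sigma> \<phi> \<and> form_free \<phi> = {}}"

type_synonym 'm team = "'m assignment set"

definition team_rel :: "'m model \<Rightarrow> 'm team \<Rightarrow> tm list \<Rightarrow> 'm list set" where
  "team_rel \<MM> X ts = (\<lambda>s. map (tm_val \<MM> s) ts) ` X"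

definition supplement :: "'m team \<Rightarrow> ('m assignment \<Rightarrow> 'm set) \<Rightarrow> nat \<Rightarrow> 'm team" where
  "supplement X H v = {s(v \<mapsto> m) | s m. s \<in> X \<and> m \<in> H s}"

primrec team_sat :: "'m model \<Rightarrow> 'm team \<Rightarrow> form \<Rightarrow> bool" where
  "team_sat \<MM> X (Pos a) \<longleftrightarrow> (\<forall>s\<in>X. atom_sat \<MM> s a)"
| "team_sat \<MM> X (Neg a) \<longleftrightarrow> (\<forall>s\<in>X. \<not> atom_sat \<MM> s a)"
| "team_sat \<MM> X (Dep D ts) \<longleftrightarrow> dep_holds (univ \<MM>) D (team_rel \<MM> X ts)"
| "team_sat \<MM> X (Or \<phi> \<psi>) \<longleftrightarrow> (\<exists>Y Z. X = Y \<union> Z \<and> team_sat \<MM> Y \<phi> \<and> team_sat \<MM> Z \<psi>)"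
| "team_sat \<MM> X (And \<phi> \<psi>) \<longleftrightarrow> team_sat \<MM> X \<phi> \<and> team_sat \<MM> X \<psi>"
| "team_sat \<MM> X (Exi v \<phi>) \<longleftrightarrow>
     (\<exists>H. (\<forall>s\<in>X. H s \<subseteq> univ \<MM> \<and> H s \<noteq> {}) \<and> team_sat \<MM> (supplement X H v) \<phi>)"
| "team_sat \<MM> X (Uni v \<phi>) \<longleftrightarrow> team_sat \<MM> (supplement X (\<lambda>_. univ \<MM>) v) \<phi>"

definition true_in :: "'m model \<Rightarrow> form \<Rightarrow> bool" where
  "true_in \<MM> \<phi> \<longleftrightarrow> team_sat \<MM> {Map.empty} \<phi>"

text \<open>HOL cannot quantify over all types inside a formula, so equivalence and safety are relative
  to a type \<open>'m\<close>: the models considered are all those whose domain is a subset of \<open>'m\<close>. With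
  \<open>'m = nat\<close> these are, up to isomorphism, the countable (finite or infinite) models. Inequivalence
  and failure of safety over \<open>nat\<close> imply inequivalence and failure of safety over the class
  of all models.\<close>

definition equivalent :: "'m itself \<Rightarrow> signature \<Rightarrow> form \<Rightarrow> form \<Rightarrow> bool" where
  "equivalent _ \<sigma> \<phi> \<psi> \<longleftrightarrow> (\<forall>\<MM> :: 'm model. is_model \<sigma> \<MM> \<longrightarrow> true_in \<MM> \<phi> = true_in \<MM> \<psi>)"

definition safe_for :: "'m itself \<Rightarrow> dependency set \<Rightarrow> dependency set \<Rightarrow> bool" where
  "safe_for T \<E> \<D> \<longleftrightarrow>
     (\<forall>\<sigma>. \<forall>\<phi>\<in>FO_sentences (\<E> \<union> \<D>) \<sigma>. \<exists>\<psi>\<in>FO_sentences \<D> \<sigma>. equivalent T \<sigma> \<phi> \<psi>)"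


section \<open>The two dependencies behave as intended\<close>

lemma is_dependency_constancy: "is_dependency constancy"
  by (auto simp: is_dependency_def constancy_def)

lemma is_dependency_unary_inclusion: "is_dependency unary_inclusion"
  by (auto simp: is_dependency_def unary_inclusion_def)

lemma constancy_atom_iff:
  assumes "\<forall>s\<in>X. tm_val \<MM> s t \<in> univ \<MM>"
  shows "team_sat \<MM> X (Dep constancy [t]) \<longleftrightarrow>
           (\<forall>s\<in>X. \<forall>s'\<in>X. tm_val \<MM> s t = tm_val \<MM> s' t)"
  using assms by (auto simp: dep_holds_def constancy_def team_rel_def)

lemma unary_inclusion_atom_iff:
  assumes "\<forall>s\<in>X. tm_val \<MM> s t \<in> univ \<MM> \<and> tm_val \<MM> s u \<in> univ \<MM>"
  shows "team_sat \<MM> X (Dep unary_inclusion [t, u]) \<longleftrightarrow>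
           (\<lambda>s. tm_val \<MM> s t) ` X \<subseteq> (\<lambda>s. tm_val \<MM> s u) ` X"
  using assms by (fastforce simp: dep_holds_def unary_inclusion_def team_rel_def image_iff)

end

theory Submission
  imports Defs "HOL-Library.Nat_Bijection"
begin

text \<open>
  With one binary relation symbol for the edges of a graph, the sentence
  \<open>\<exists>x (=(x) \<and> \<exists>y (y \<noteq> x \<and> \<forall>z (\<not> Ryz \<or> z \<subseteq> y)))\<close> says that the graph is disconnected: the values
  of \<open>y\<close> form a nonempty set that is closed under neighbours, and constancy provides one fixed
  vertex outside of that set. No sentence of FO(\<open>\<subseteq>\<^sub>1\<close>) says this, because every such sentence that
  is true in the disjoint union of two bi-infinite paths is also true in a single one.

  As for first order logic, this comes from a back-and-forth argument, in which two tuples are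
  similar up to radius \<open>n\<close> if their entries have the same signed distances whenever these are at
  most \<open>n\<close>; halving the radius pays for one quantifier (\<open>similar_extend\<close>). Lifted to teams, the
  invariant is that every assignment of either team is similar to one of the other team. This
  passes through all connectives and quantifiers, but it does not by itself preserve inclusion atoms.
  Since the single path is vertex transitive, one may in addition keep the team over it closed
  under all symmetries of the path. In a nonempty team with this property every variable takes
  every value, so that all unary inclusions hold there (\<open>transfer\<close>). The clauses for connectives
  and quantifiers preserve this property as well, and the team of the empty assignment has it. A
  constancy atom, in contrast, is false in each nonempty team of this kind.
\<close>

section \<open>Disjoint unions of bi-infinite paths\<close>

text \<open>The vertices are named by coordinates: the path that a vertex lies on, and its position on
  that path. The second condition says that paths have no ends.\<close>

definition path_coords :: "('a \<Rightarrow> 'c \<times> int) \<Rightarrow> bool" where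
  "path_coords c \<longleftrightarrow> inj c \<and> (\<forall>a d. \<exists>b. c b = (fst (c a), snd (c a) + d))"

text \<open>All that is visible within radius \<open>n\<close>: vertices at a larger distance look as if they were on
  different paths. Distances are signed so that adding them locates a vertex.\<close>

definition near :: "('a \<Rightarrow> 'c \<times> int) \<Rightarrow> int \<Rightarrow> 'a \<Rightarrow> 'a \<Rightarrow> int option" where
  "near c n a b =
     (if fst (c a) = fst (c b) \<and> \<bar>snd (c b) - snd (c a)\<bar> \<le> n then Some (snd (c b) - snd (c a)) else None)"

definition paths :: "('a \<Rightarrow> 'c \<times> int) \<Rightarrow> 'a model" where
  "paths c = \<lparr>univ = UNIV, fn = undefined,
     rel = (\<lambda>_. {[a, b] | a b. near c 1 a b \<in> {Some 1, Some (- 1)}})\<rparr>"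

definition graph_sig :: signature where
  "graph_sig = \<lparr>fn_ar = Map.empty, rel_ar = [0 \<mapsto> 2]\<rparr>"

lemma univ_paths [simp]: "univ (paths c) = UNIV"
  by (simp add: paths_def)

lemma near_Some_iff:
  "near c n a b = Some d \<longleftrightarrow> fst (c a) = fst (c b) \<and> snd (c b) - snd (c a) = d \<and> \<bar>d\<bar> \<le> n"
  by (auto simp: near_def)

lemma near_commute: "near c n b a = map_option uminus (near c n a b)"
  by (auto simp: near_def)

lemma near_refl: "0 \<le> n \<Longrightarrow> near c n a a = Some 0"
  by (simp add: near_def)

lemma near_eq_smaller:
  assumes "near c n a b = near c' n a' b'" and "m \<le> n"
  shows "near c m a b = near c' m a' b'"
proof -
  have restrict: "near e m u v = (case near e n u v of None \<Rightarrow> None | Some d \<Rightarrow> if \<bar>d\<bar> \<le> m then Some d else None)"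
    for e :: "'x \<Rightarrow> 'y \<times> int" and u v
    using assms(2) by (auto simp: near_def)
  show ?thesis
    unfolding restrict[of c] restrict[of c'] assms(1) ..
qed

lemma near_0_iff_eq: "inj c \<Longrightarrow> near c n a b = Some 0 \<and> 0 \<le> n \<longleftrightarrow> a = b \<and> 0 \<le> n"
  by (auto simp: near_Some_iff prod_eq_iff inj_def)

text \<open>Paths are infinite, so that finitely many vertices do not come close to all others.\<close>

lemma far_vertex_exists:
  assumes "path_coords c" and "finite A"
  obtains b where "\<And>a. a \<in> A \<Longrightarrow> near c n a b = None"
proof -
  obtain u :: int where u: "\<And>a. a \<in> A \<Longrightarrow> snd (c a) \<le> u"
    using finite_imageI[OF assms(2), of "\<lambda>a. snd (c a)"] by (metis Max_ge imageI)
  obtain b where "snd (c b) = u + \<bar>n\<bar> + 1"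
    using assms(1) unfolding path_coords_def
    by (metis add.commute diff_add_cancel snd_conv)
  then have "near c n a b = None" if "a \<in> A" for a
    using u[OF that] by (auto simp: near_def)
  then show thesis by (rule that)
qed


section \<open>Similar assignments\<close>

definition similar ::
  "('a \<Rightarrow> 'c \<times> int) \<Rightarrow> ('b \<Rightarrow> 'd \<times> int) \<Rightarrow> nat set \<Rightarrow> int \<Rightarrow> 'a assignment \<Rightarrow> 'b assignment \<Rightarrow> bool" where
  "similar c c' V n s t \<longleftrightarrow>
     (\<forall>x\<in>V. \<forall>y\<in>V. near c n (the (s x)) (the (s y)) = near c' n (the (t x)) (the (t y)))"

lemma similar_sym: "similar c c' V n s t \<longleftrightarrow> similar c' c V n t s"
  by (auto simp: similar_def)

text \<open>If the new entry \<open>a\<close> is close to an old one, then its counterpart is placed at the same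
  offset from the counterpart of the old one. The offset to any other old entry
  close to \<open>a\<close> is then right too, because the two old entries are within distance \<open>2 n\<close> by the triangle
  inequality.\<close>

lemma similar_extend:
  assumes c': "path_coords c'" and "finite V" and "0 \<le> n"
    and sim: "similar c c' V (2 * n) s t"
  shows "\<exists>b. similar c c' (insert v V) n (s(v \<mapsto> a)) (t(v \<mapsto> b))"
proof -
  let ?s = "\<lambda>x. the (s x)" and ?t = "\<lambda>x. the (t x)"
  have sim2: "near c (2 * n) (?s y) (?s x) = near c' (2 * n) (?t y) (?t x)" if "x \<in> V" "y \<in> V" for x y
    using sim that by (auto simp: similar_def)
  have "\<exists>b. \<forall>y\<in>V. near c n (?s y) a = near c' n (?t y) b"
  proof (cases "\<exists>x\<in>V. \<exists>d. near c n (?s x) a = Some d")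
    case True
    then obtain x d where x: "x \<in> V" and d: "near c n (?s x) a = Some d" by blast
    obtain b where b: "c' b = (fst (c' (?t x)), snd (c' (?t x)) + d)"
      using c' unfolding path_coords_def by blast
    have same: "near c n (?s y) a = Some e \<longleftrightarrow> near c' n (?t y) b = Some e" if "y \<in> V" for y e
    proof
      assume "near c n (?s y) a = Some e"
      with d have "near c (2 * n) (?s y) (?s x) = Some (e - d)" "\<bar>e\<bar> \<le> n"
        by (auto simp: near_Some_iff)
      moreover from this have "near c' (2 * n) (?t y) (?t x) = Some (e - d)"
        using sim2[OF x that] by simp
      ultimately show "near c' n (?t y) b = Some e"
        using b by (auto simp: near_Some_iff)
    next
      assume e: "near c' n (?t y) b = Some e"
      then have "near c' (2 * n) (?t y) (?t x) = Some (e - d)"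
        using d b by (auto simp: near_Some_iff)
      then have "near c (2 * n) (?s y) (?s x) = Some (e - d)"
        using sim2[OF x that] by simp
      with d e show "near c n (?s y) a = Some e"
        by (auto simp: near_Some_iff)
    qed
    have "near c n (?s y) a = near c' n (?t y) b" if "y \<in> V" for y
      using same[OF that] by (metis option.exhaust)
    then show ?thesis by blast
  next
    case False
    obtain b where "\<And>a. a \<in> ?t ` V \<Longrightarrow> near c' n a b = None"
      using far_vertex_exists[OF c', of "?t ` V"] \<open>finite V\<close> by blast
    with False show ?thesis by (intro exI[of _ b]) auto
  qed
  then obtain b where b: "\<And>y. y \<in> V \<Longrightarrow> near c n (?s y) a = near c' n (?t y) b" by blast
  have "near c n a (?s y) = near c' n b (?t y)" if "y \<in> V" for y
    using b[OF that] by (simp add: near_commute[of _ _ a] near_commute[of _ _ b])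
  moreover have "near c n (?s x) (?s y) = near c' n (?t x) (?t y)" if "x \<in> V" "y \<in> V" for x y
    using sim2[OF that(2,1)] by (rule near_eq_smaller) (use \<open>0 \<le> n\<close> in simp)
  ultimately have "similar c c' (insert v V) n (s(v \<mapsto> a)) (t(v \<mapsto> b))"
    using b \<open>0 \<le> n\<close> by (auto simp: similar_def near_refl)
  then show ?thesis ..
qed

lemma tm_over_graph_sig: "tm_over graph_sig t \<Longrightarrow> \<exists>x. t = Var x"
  by (cases t) (auto simp: graph_sig_def)

lemma similar_atom_sat:
  assumes "path_coords c" and "path_coords c'" and sim: "similar c c' V n s t" and "1 \<le> n"
    and "atom_over graph_sig \<alpha>" and "atom_vars \<alpha> \<subseteq> V"
  shows "atom_sat (paths c) s \<alpha> \<longleftrightarrow> atom_sat (paths c') t \<alpha>"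
proof -
  have inj: "inj c" "inj c'" using assms(1,2) by (auto simp: path_coords_def)
  have sim': "near c n (the (s x)) (the (s y)) = near c' n (the (t x)) (the (t y))" if "x \<in> V" "y \<in> V" for x y
    using sim that by (auto simp: similar_def)
  show ?thesis
  proof (cases \<alpha>)
    case (Eq u w)
    with assms(5) obtain x y where [simp]: "u = Var x" "w = Var y"
      using tm_over_graph_sig by fastforce
    have "x \<in> V" "y \<in> V" using assms(6) Eq by auto
    from sim'[OF this] show ?thesis
      using near_0_iff_eq[OF inj(1), of n "the (s x)" "the (s y)"]
        near_0_iff_eq[OF inj(2), of n "the (t x)" "the (t y)"] \<open>1 \<le> n\<close> by (simp add: Eq)
  next
    case (Rel r ts)
    with assms(5) have "length ts = 2" "list_all (tm_over graph_sig) ts"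
      by (auto simp: graph_sig_def split: if_splits)
    then obtain x y where [simp]: "ts = [Var x, Var y]"
      by (auto simp: numeral_2_eq_2 length_Suc_conv dest!: tm_over_graph_sig)
    have "x \<in> V" "y \<in> V" using assms(6) Rel by auto
    from near_eq_smaller[OF sim'[OF this] \<open>1 \<le> n\<close>] show ?thesis
      by (simp add: Rel paths_def)
  qed
qed


section \<open>Similar teams\<close>

text \<open>Preserving all near distances is what leaves the similarity of assignments invariant.\<close>

definition symmetry :: "('a \<Rightarrow> 'c \<times> int) \<Rightarrow> ('a \<Rightarrow> 'a) \<Rightarrow> bool" where
  "symmetry c g \<longleftrightarrow> (\<forall>n a b. near c n (g a) (g b) = near c n a b)"

definition closed_under_symmetry :: "('a \<Rightarrow> 'c \<times> int) \<Rightarrow> 'a team \<Rightarrow> bool" where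
  "closed_under_symmetry c Y \<longleftrightarrow> (\<forall>g. symmetry c g \<longrightarrow> (\<forall>t\<in>Y. map_option g \<circ> t \<in> Y))"

lemma similar_symmetry:
  assumes "symmetry c' g" and "V \<subseteq> dom t" and "similar c c' V n s t"
  shows "similar c c' V n s (map_option g \<circ> t)"
proof -
  have "the ((map_option g \<circ> t) x) = g (the (t x))" if "x \<in> V" for x
    using that assms(2) by (auto simp: subset_iff)
  then show ?thesis using assms(1,3) by (simp add: similar_def symmetry_def)
qed

lemma map_option_upd: "map_option g \<circ> t(v \<mapsto> b) = (map_option g \<circ> t)(v \<mapsto> g b)"
  by (auto simp: fun_eq_iff)

text \<open>Closure under symmetries is demanded of the second team only, because truth is going to be
  transferred from the first to the second; the inclusion atom would not survive the way back.\<close>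

definition similar_teams ::
  "('a \<Rightarrow> 'c \<times> int) \<Rightarrow> ('b \<Rightarrow> 'd \<times> int) \<Rightarrow> nat set \<Rightarrow> int \<Rightarrow> 'a team \<Rightarrow> 'b team \<Rightarrow> bool" where
  "similar_teams c c' V n X Y \<longleftrightarrow>
     (\<forall>t\<in>Y. V \<subseteq> dom t) \<and> closed_under_symmetry c' Y \<and>
     (\<forall>s\<in>X. \<exists>t\<in>Y. similar c c' V n s t) \<and> (\<forall>t\<in>Y. \<exists>s\<in>X. similar c c' V n s t)"

primrec quantifier_rank :: "form \<Rightarrow> nat" where
  "quantifier_rank (Pos \<alpha>) = 0"
| "quantifier_rank (Neg \<alpha>) = 0"
| "quantifier_rank (Dep D ts) = 0"
| "quantifier_rank (Or \<phi> \<psi>) = max (quantifier_rank \<phi>) (quantifier_rank \<psi>)"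
| "quantifier_rank (And \<phi> \<psi>) = max (quantifier_rank \<phi>) (quantifier_rank \<psi>)"
| "quantifier_rank (Exi v \<phi>) = Suc (quantifier_rank \<phi>)"
| "quantifier_rank (Uni v \<phi>) = Suc (quantifier_rank \<phi>)"

text \<open>A splitting of the first team induces one of the second: an assignment goes to all parts
  that contain something similar. The parts stay closed under symmetries because
  similarity is invariant under symmetries.\<close>

lemma similar_teams_part:
  assumes "similar_teams c c' V n X Y" and "X' \<subseteq> X"
  shows "similar_teams c c' V n X' {t \<in> Y. \<exists>s\<in>X'. similar c c' V n s t}"
proof -
  let ?Y' = "{t \<in> Y. \<exists>s\<in>X'. similar c c' V n s t}"
  have "map_option g \<circ> t \<in> ?Y'" if g: "symmetry c' g" and t: "t \<in> ?Y'" for g t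
  proof -
    have "V \<subseteq> dom t" "map_option g \<circ> t \<in> Y"
      using assms(1) g t by (auto simp: similar_teams_def closed_under_symmetry_def)
    then show ?thesis
      using t similar_symmetry[OF g] by blast
  qed
  then have closed: "closed_under_symmetry c' ?Y'"
    unfolding closed_under_symmetry_def by blast
  have forth: "\<exists>t\<in>?Y'. similar c c' V n s t" if "s \<in> X'" for s
  proof -
    have "s \<in> X" using that assms(2) by blast
    then obtain t where "t \<in> Y" "similar c c' V n s t"
      using assms(1) unfolding similar_teams_def by blast
    with \<open>s \<in> X'\<close> show ?thesis by blast
  qed
  show ?thesis
    unfolding similar_teams_def
  proof (intro conjI ballI)
    show "V \<subseteq> dom t" if "t \<in> ?Y'" for t
      using assms(1) that by (simp add: similar_teams_def)
    show "\<exists>s\<in>X'. similar c c' V n s t" if "t \<in> ?Y'" for t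
      using that by simp
  qed (fact closed forth)+
qed

text \<open>The new values in the second team are all those that create something similar to an
  assignment of the extended first team. This choice is canonical and so compatible with symmetries.\<close>

lemma similar_teams_supplement:
  fixes v :: nat
  assumes c: "path_coords c'" and V: "finite V" and n: "0 \<le> n"
    and sim: "similar_teams c c' V (2 * n) X Y"
    and H: "\<forall>s\<in>X. H s \<noteq> {}"
  defines "K \<equiv> \<lambda>t. {b. \<exists>s\<in>X. \<exists>a\<in>H s. similar c c' (insert v V) n (s(v \<mapsto> a)) (t(v \<mapsto> b))}"
  shows "similar_teams c c' (insert v V) n (supplement X H v) (supplement Y K v)"
    and "\<forall>t\<in>Y. K t \<noteq> {}"
proof -
  have extend: "\<exists>b. b \<in> K t \<and> similar c c' (insert v V) n (s(v \<mapsto> a)) (t(v \<mapsto> b))"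
    if "s \<in> X" "a \<in> H s" "similar c c' V (2 * n) s t" for s a t
    using similar_extend[OF c V n that(3), of v a] that(1,2) by (auto simp: K_def)
  show "\<forall>t\<in>Y. K t \<noteq> {}"
    using sim H extend unfolding similar_teams_def by fastforce
  have dom: "insert v V \<subseteq> dom (t(v \<mapsto> b))" if "t \<in> Y" for t b
    using sim that by (auto simp: similar_teams_def)
  have "closed_under_symmetry c' (supplement Y K v)"
    unfolding closed_under_symmetry_def
  proof (intro allI impI ballI)
    fix g u assume g: "symmetry c' g" and "u \<in> supplement Y K v"
    then obtain t b where u: "u = t(v \<mapsto> b)" and t: "t \<in> Y" and b: "b \<in> K t"
      by (auto simp: supplement_def)
    have "map_option g \<circ> t \<in> Y"
      using sim g t by (auto simp: similar_teams_def closed_under_symmetry_def)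
    moreover have "g b \<in> K (map_option g \<circ> t)"
      using b similar_symmetry[OF g dom[OF t]] unfolding K_def map_option_upd by blast
    ultimately show "map_option g \<circ> u \<in> supplement Y K v"
      unfolding u map_option_upd supplement_def by blast
  qed
  moreover have "\<exists>t\<in>supplement Y K v. similar c c' (insert v V) n u t" if u: "u \<in> supplement X H v" for u
  proof -
    obtain s a where s: "u = s(v \<mapsto> a)" "s \<in> X" "a \<in> H s"
      using u by (auto simp: supplement_def)
    then obtain t where t: "t \<in> Y" "similar c c' V (2 * n) s t"
      using sim unfolding similar_teams_def by blast
    obtain b where b: "b \<in> K t" "similar c c' (insert v V) n u (t(v \<mapsto> b))"
      using extend[OF s(2,3) t(2)] s(1) by blast
    have "t(v \<mapsto> b) \<in> supplement Y K v"
      using t(1) b(1) unfolding supplement_def by blast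
    with b(2) show ?thesis ..
  qed
  moreover have "\<exists>s\<in>supplement X H v. similar c c' (insert v V) n s u" if u: "u \<in> supplement Y K v" for u
  proof -
    obtain t b where "u = t(v \<mapsto> b)" "b \<in> K t"
      using u by (auto simp: supplement_def)
    then obtain s a where "s \<in> X" "a \<in> H s" "similar c c' (insert v V) n (s(v \<mapsto> a)) u"
      by (auto simp: K_def)
    moreover have "s(v \<mapsto> a) \<in> supplement X H v"
      using calculation(1,2) unfolding supplement_def by blast
    ultimately show ?thesis by blast
  qed
  moreover have "\<forall>u\<in>supplement Y K v. insert v V \<subseteq> dom u"
    using dom unfolding supplement_def by blast
  ultimately show "similar_teams c c' (insert v V) n (supplement X H v) (supplement Y K v)"
    unfolding similar_teams_def by blast
qed

text \<open>For the universal quantifier, the canonical choice is everything: also from the second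
  structure to the first, any new value has a counterpart.\<close>

lemma similar_teams_duplicate:
  assumes c: "path_coords c" "path_coords c'" and V: "finite V" and n: "0 \<le> n"
    and sim: "similar_teams c c' V (2 * n) X Y"
  shows "similar_teams c c' (insert v V) n (supplement X (\<lambda>_. UNIV) v) (supplement Y (\<lambda>_. UNIV) v)"
proof -
  let ?K = "\<lambda>t. {b. \<exists>s\<in>X. \<exists>a\<in>UNIV. similar c c' (insert v V) n (s(v \<mapsto> a)) (t(v \<mapsto> b))}"
  have "?K t = UNIV" if "t \<in> Y" for t
  proof -
    obtain s where "s \<in> X" "similar c c' V (2 * n) s t"
      using sim \<open>t \<in> Y\<close> unfolding similar_teams_def by blast
    then show ?thesis
      using similar_extend[OF c(1) V n, of c' t s v] unfolding similar_sym[of c c'] by blast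
  qed
  then have "supplement Y ?K v = supplement Y (\<lambda>_. UNIV) v"
    unfolding supplement_def by blast
  with similar_teams_supplement(1)[OF c(2) V n sim, of "\<lambda>_. UNIV" v] show ?thesis
    by simp
qed

text \<open>Transitivity serves the inclusion atoms: an assignment of the second team can be moved by a
  symmetry so that any given variable of its domain takes any desired value. Hence the second team
  satisfies every inclusion between such variables.\<close>

lemma transfer:
  assumes c: "path_coords c" "path_coords c'"
    and transitive: "\<And>a b. \<exists>g. symmetry c' g \<and> g a = b"
  shows "\<lbrakk>in_FO {unary_inclusion} graph_sig \<phi>; form_free \<phi> \<subseteq> V; finite V; quantifier_rank \<phi> \<le> r;
      similar_teams c c' V (2 ^ r) X Y; team_sat (paths c) X \<phi>\<rbrakk> \<Longrightarrow> team_sat (paths c') Y \<phi>"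
proof (induction \<phi> arbitrary: V r X Y)
  case (Pos \<alpha>)
  show ?case unfolding team_sat.simps
  proof
    fix t assume "t \<in> Y"
    then obtain s where "s \<in> X" "similar c c' V (2 ^ r) s t"
      using Pos.prems(5) by (auto simp: similar_teams_def)
    then show "atom_sat (paths c') t \<alpha>"
      using Pos.prems similar_atom_sat[OF c, of V "2 ^ r" s t \<alpha>] by simp
  qed
next
  case (Neg \<alpha>)
  show ?case unfolding team_sat.simps
  proof
    fix t assume "t \<in> Y"
    then obtain s where "s \<in> X" "similar c c' V (2 ^ r) s t"
      using Neg.prems(5) by (auto simp: similar_teams_def)
    then show "\<not> atom_sat (paths c') t \<alpha>"
      using Neg.prems similar_atom_sat[OF c, of V "2 ^ r" s t \<alpha>] by simp
  qed
next
  case (Dep D ts)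
  from Dep.prems(1) have "D = unary_inclusion" "length ts = 2" "list_all (tm_over graph_sig) ts"
    by (auto simp: unary_inclusion_def)
  then obtain x y where D: "D = unary_inclusion" and ts: "ts = [Var x, Var y]"
    by (auto simp: numeral_2_eq_2 length_Suc_conv dest!: tm_over_graph_sig)
  have "y \<in> V" using Dep.prems(2) by (simp add: ts)
  have "\<exists>t'\<in>Y. the (t x) = the (t' y)" if "t \<in> Y" for t
  proof -
    obtain g where g: "symmetry c' g" "g (the (t y)) = the (t x)" using transitive by blast
    have "map_option g \<circ> t \<in> Y" "y \<in> dom t"
      using g(1) that \<open>y \<in> V\<close> Dep.prems(5) by (auto simp: similar_teams_def closed_under_symmetry_def)
    with g(2) show ?thesis by (intro bexI[of _ "map_option g \<circ> t"]) auto
  qed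
  then show ?case
    unfolding D ts by (subst unary_inclusion_atom_iff) (auto simp: image_iff)
next
  case (Or \<phi> \<psi>)
  let ?part = "\<lambda>X'. {t \<in> Y. \<exists>s\<in>X'. similar c c' V (2 ^ r) s t}"
  obtain X1 X2 where X: "X = X1 \<union> X2" and sat: "team_sat (paths c) X1 \<phi>" "team_sat (paths c) X2 \<psi>"
    using Or.prems(6) by auto
  note part = similar_teams_part[OF Or.prems(5)]
  have "team_sat (paths c') (?part X1) \<phi>"
    by (rule Or.IH(1)[OF _ _ _ _ part sat(1)]) (use Or.prems X in auto)
  moreover have "team_sat (paths c') (?part X2) \<psi>"
    by (rule Or.IH(2)[OF _ _ _ _ part sat(2)]) (use Or.prems X in auto)
  moreover have "Y = ?part X1 \<union> ?part X2"
    using Or.prems(5) unfolding X similar_teams_def by blast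
  ultimately show ?case unfolding team_sat.simps by blast
next
  case (And \<phi> \<psi>)
  then show ?case by auto
next
  case (Exi v \<phi>)
  obtain q where r: "r = Suc q" and q: "quantifier_rank \<phi> \<le> q"
    using Exi.prems(4) by (cases r) auto
  obtain H where H: "\<forall>s\<in>X. H s \<noteq> {}" and sat: "team_sat (paths c) (supplement X H v) \<phi>"
    using Exi.prems(6) by auto
  let ?K = "\<lambda>t. {b. \<exists>s\<in>X. \<exists>a\<in>H s. similar c c' (insert v V) (2 ^ q) (s(v \<mapsto> a)) (t(v \<mapsto> b))}"
  have sim: "similar_teams c c' V (2 * 2 ^ q) X Y" using Exi.prems(5) by (simp add: r)
  note ext = similar_teams_supplement[OF c(2) Exi.prems(3) _ sim H]
  have "team_sat (paths c') (supplement Y ?K v) \<phi>"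
    by (rule Exi.IH[OF _ _ _ q ext(1) sat]) (use Exi.prems in auto)
  moreover have "\<forall>t\<in>Y. ?K t \<noteq> {}" by (rule ext(2)) simp
  ultimately show ?case
    unfolding team_sat.simps(6) univ_paths by (intro exI[of _ ?K] conjI) simp_all
next
  case (Uni v \<phi>)
  obtain q where r: "r = Suc q" and q: "quantifier_rank \<phi> \<le> q"
    using Uni.prems(4) by (cases r) auto
  have sim: "similar_teams c c' V (2 * 2 ^ q) X Y" using Uni.prems(5) by (simp add: r)
  have sat: "team_sat (paths c) (supplement X (\<lambda>_. UNIV) v) \<phi>" using Uni.prems(6) by simp
  have "team_sat (paths c') (supplement Y (\<lambda>_. UNIV) v) \<phi>"
    by (rule Uni.IH[OF _ _ _ q similar_teams_duplicate[OF c Uni.prems(3) _ sim] sat])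
      (use Uni.prems in auto)
  then show ?case by simp
qed

corollary transfer_sentence:
  assumes "path_coords c" and "path_coords c'"
    and "\<And>a b. \<exists>g. symmetry c' g \<and> g a = b"
    and "\<phi> \<in> FO_sentences {unary_inclusion} graph_sig" and "true_in (paths c) \<phi>"
  shows "true_in (paths c') \<phi>"
proof -
  have "map_option g \<circ> Map.empty = Map.empty" for g :: "'b \<Rightarrow> 'b"
    by (simp add: fun_eq_iff)
  then have "similar_teams c c' {} (2 ^ quantifier_rank \<phi>) {Map.empty} {Map.empty}"
    by (simp add: similar_teams_def closed_under_symmetry_def similar_def)
  from transfer[OF assms(1-3) _ _ _ order.refl this] assms(4,5) show ?thesis
    by (simp add: true_in_def FO_sentences_def)
qed


section \<open>Disconnectedness\<close>

definition disconnected :: form where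
  "disconnected =
     Exi 0 (And (Dep constancy [Var 0])
       (Exi 1 (And (Neg (Eq (Var 1) (Var 0)))
         (Uni 2 (Or (Neg (Rel 0 [Var 1, Var 2])) (Dep unary_inclusion [Var 2, Var 1]))))))"

lemma disconnected_sentence: "disconnected \<in> FO_sentences ({constancy} \<union> {unary_inclusion}) graph_sig"
  by (simp add: FO_sentences_def disconnected_def graph_sig_def constancy_def unary_inclusion_def) blast

text \<open>For the existential quantifiers, \<open>y\<close> ranges over \<open>S\<close>, and \<open>x\<close> is the vertex \<open>a\<close>. The
  disjunction is satisfied by sending an assignment to the inclusion atom exactly when \<open>z\<close> lies in \<open>S\<close>.\<close>

lemma disconnectedI:
  assumes univ: "univ \<MM> = UNIV" and S: "S \<noteq> {}" "a \<notin> S"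
    and closed: "\<And>b d. b \<in> S \<Longrightarrow> [b, d] \<in> rel \<MM> 0 \<Longrightarrow> d \<in> S"
  shows "true_in \<MM> disconnected"
proof -
  let ?X = "{[0 \<mapsto> a]}"
  let ?Y = "{[0 \<mapsto> a, 1 \<mapsto> b] | b. b \<in> S}"
  let ?Z = "{[0 \<mapsto> a, 1 \<mapsto> b, 2 \<mapsto> d] | b d. b \<in> S}"
  let ?in = "{[0 \<mapsto> a, 1 \<mapsto> b, 2 \<mapsto> d] | b d. b \<in> S \<and> d \<in> S}"
  let ?out = "{[0 \<mapsto> a, 1 \<mapsto> b, 2 \<mapsto> d] | b d. b \<in> S \<and> d \<notin> S}"
  have supp: "supplement {Map.empty} (\<lambda>_. {a}) 0 = ?X" "supplement ?X (\<lambda>_. S) 1 = ?Y"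
    "supplement ?Y (\<lambda>_. UNIV) 2 = ?Z"
    by (auto simp: supplement_def)
  have "team_sat \<MM> ?out (Neg (Rel 0 [Var 1, Var 2]))"
    using closed by auto
  moreover have "team_sat \<MM> ?in (Dep unary_inclusion [Var 2, Var 1])"
    using univ by (subst unary_inclusion_atom_iff) (fastforce simp: image_iff)+
  moreover have "?Z = ?out \<union> ?in" by blast
  ultimately have "team_sat \<MM> ?Z (Or (Neg (Rel 0 [Var 1, Var 2])) (Dep unary_inclusion [Var 2, Var 1]))"
    unfolding team_sat.simps(4) by blast
  moreover have "team_sat \<MM> ?Y (Neg (Eq (Var 1) (Var 0)))"
    using S(2) by auto
  ultimately have "team_sat \<MM> ?Y (And (Neg (Eq (Var 1) (Var 0)))
      (Uni 2 (Or (Neg (Rel 0 [Var 1, Var 2])) (Dep unary_inclusion [Var 2, Var 1]))))"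
    unfolding team_sat.simps(5,7) univ supp by blast
  then have "team_sat \<MM> ?X (Exi 1 (And (Neg (Eq (Var 1) (Var 0)))
      (Uni 2 (Or (Neg (Rel 0 [Var 1, Var 2])) (Dep unary_inclusion [Var 2, Var 1])))))"
    unfolding team_sat.simps(6)[of \<MM> ?X] using S(1) univ supp(2) by (intro exI[of _ "\<lambda>_. S"]) simp
  moreover have "team_sat \<MM> ?X (Dep constancy [Var 0])"
    by (subst constancy_atom_iff) (auto simp: univ)
  ultimately show ?thesis
    unfolding true_in_def disconnected_def team_sat.simps(6)[of \<MM> "{Map.empty}"]
    using univ supp(1) by (intro exI[of _ "\<lambda>_. {a}"]) simp
qed

text \<open>Constancy leaves a single value \<open>a\<close> for \<open>x\<close>. Therefore the requirement \<open>y \<noteq> x\<close>, which compares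
  values within one assignment, excludes \<open>a\<close> from the set \<open>S\<close> of all values of \<open>y\<close>. All pairs of
  neighbours must go to the inclusion atom, and so \<open>S\<close> is closed under neighbours.\<close>

lemma disconnectedE:
  assumes univ: "univ \<MM> = UNIV" and "true_in \<MM> disconnected"
  obtains a S where "S \<noteq> {}" and "a \<notin> S"
    and "\<And>b d. b \<in> S \<Longrightarrow> [b, d] \<in> rel \<MM> 0 \<Longrightarrow> d \<in> S"
proof -
  obtain H where H: "H Map.empty \<noteq> {}"
    and const: "team_sat \<MM> (supplement {Map.empty} H 0) (Dep constancy [Var 0])"
    and rest: "team_sat \<MM> (supplement {Map.empty} H 0) (Exi 1 (And (Neg (Eq (Var 1) (Var 0)))
      (Uni 2 (Or (Neg (Rel 0 [Var 1, Var 2])) (Dep unary_inclusion [Var 2, Var 1])))))"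
    using assms(2) unfolding true_in_def disconnected_def team_sat.simps(5)
      team_sat.simps(6)[of \<MM> "{Map.empty}"] by blast
  obtain a where a: "a \<in> H Map.empty" using H by blast
  have "b = a" if "b \<in> H Map.empty" for b
  proof -
    have "\<forall>s\<in>supplement {Map.empty} H 0. \<forall>s'\<in>supplement {Map.empty} H 0. tm_val \<MM> s (Var 0) = tm_val \<MM> s' (Var 0)"
      by (rule iffD1[OF constancy_atom_iff const]) (simp add: univ)
    moreover have "[0 \<mapsto> a] \<in> supplement {Map.empty} H 0" "[0 \<mapsto> b] \<in> supplement {Map.empty} H 0"
      using a that by (auto simp: supplement_def)
    ultimately have "tm_val \<MM> [0 \<mapsto> b] (Var 0) = tm_val \<MM> [0 \<mapsto> a] (Var 0)" by blast
    then show ?thesis by simp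
  qed
  with a have "H Map.empty = {a}" by blast
  then have X: "supplement {Map.empty} H 0 = {[0 \<mapsto> a]}" by (simp add: supplement_def)
  obtain K where K: "K [0 \<mapsto> a] \<noteq> {}"
    and sat: "team_sat \<MM> (supplement {[0 \<mapsto> a]} K 1) (And (Neg (Eq (Var 1) (Var 0)))
      (Uni 2 (Or (Neg (Rel 0 [Var 1, Var 2])) (Dep unary_inclusion [Var 2, Var 1]))))"
    using rest unfolding X team_sat.simps(6) by blast
  define S where "S = K [0 \<mapsto> a]"
  have Y: "supplement {[0 \<mapsto> a]} K 1 = {[0 \<mapsto> a, 1 \<mapsto> b] | b. b \<in> S}"
    by (auto simp: supplement_def S_def)
  have Z: "supplement {[0 \<mapsto> a, 1 \<mapsto> b] | b. b \<in> S} (\<lambda>_. UNIV) 2 = {[0 \<mapsto> a, 1 \<mapsto> b, 2 \<mapsto> d] | b d. b \<in> S}"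
    by (auto simp: supplement_def)
  have "a \<notin> S" using sat unfolding Y by auto
  obtain P Q where PQ: "{[0 \<mapsto> a, 1 \<mapsto> b, 2 \<mapsto> d] | b d. b \<in> S} = P \<union> Q"
    and P: "team_sat \<MM> P (Neg (Rel 0 [Var 1, Var 2]))"
    and Q: "team_sat \<MM> Q (Dep unary_inclusion [Var 2, Var 1])"
    using sat by (simp only: Y team_sat.simps(4,5,7) univ Z) blast
  have "d \<in> S" if "b \<in> S" "[b, d] \<in> rel \<MM> 0" for b d
  proof -
    let ?u = "[0 \<mapsto> a, 1 \<mapsto> b, 2 \<mapsto> d] :: 'a assignment"
    have "?u \<notin> P" using P that(2) by auto
    then have "?u \<in> Q" using PQ that(1) by blast
    moreover have "(\<lambda>s. tm_val \<MM> s (Var 2)) ` Q \<subseteq> (\<lambda>s. tm_val \<MM> s (Var 1)) ` Q"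
      by (rule iffD1[OF unary_inclusion_atom_iff Q]) (simp add: univ)
    ultimately have "tm_val \<MM> ?u (Var 2) \<in> (\<lambda>s. tm_val \<MM> s (Var 1)) ` Q"
      by blast
    then obtain w where "w \<in> Q" "d = the (w 1)" by auto
    moreover have "w \<in> {[0 \<mapsto> a, 1 \<mapsto> b, 2 \<mapsto> d] | b d. b \<in> S}"
      using PQ \<open>w \<in> Q\<close> by blast
    ultimately show ?thesis by auto
  qed
  with K \<open>a \<notin> S\<close> that[of S a] show thesis by (auto simp: S_def)
qed


section \<open>One path and two paths\<close>

definition one_path :: "nat \<Rightarrow> nat \<times> int" where
  "one_path a = (0, int_decode a)"

definition two_paths :: "nat \<Rightarrow> nat \<times> int" where
  "two_paths a = (a mod 2, int_decode (a div 2))"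

lemma is_model_paths: "is_model graph_sig (paths (c :: nat \<Rightarrow> 'c \<times> int))"
  by (auto simp: is_model_def graph_sig_def paths_def intro!: bexI[of _ "0::nat"] bexI[of _ "1::nat"])

lemma path_coords_one_path: "path_coords one_path"
  unfolding path_coords_def
proof (intro conjI allI)
  show "inj one_path" by (rule injI) (metis one_path_def Pair_inject int_decode_eq)
  show "\<exists>b. one_path b = (fst (one_path a), snd (one_path a) + d)" for a d
    by (intro exI[of _ "int_encode (int_decode a + d)"]) (simp add: one_path_def)
qed

lemma path_coords_two_paths: "path_coords two_paths"
  unfolding path_coords_def
proof (intro conjI allI)
  show "inj two_paths"
    by (rule injI) (metis two_paths_def Pair_inject int_decode_eq mult_div_mod_eq)
  show "\<exists>b. two_paths b = (fst (two_paths a), snd (two_paths a) + d)" for a d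
    by (intro exI[of _ "a mod 2 + 2 * int_encode (int_decode (a div 2) + d)"]) (simp add: two_paths_def)
qed

lemma one_path_transitive: "\<exists>g. symmetry one_path g \<and> g a = b"
  by (intro exI[of _ "\<lambda>x. int_encode (int_decode x + (int_decode b - int_decode a))"])
    (simp add: symmetry_def near_def one_path_def)

lemma two_paths_disconnected: "true_in (paths two_paths) disconnected"
  by (rule disconnectedI[where S = "{a. even a}" and a = 1])
    (auto simp: paths_def near_Some_iff two_paths_def even_iff_mod_2_eq_zero intro: exI[of _ 0])

lemma one_path_connected: "\<not> true_in (paths one_path) disconnected"
proof
  assume "true_in (paths one_path) disconnected"
  then obtain a S where S: "S \<noteq> {}" and "a \<notin> S"
    and closed: "\<And>b d. b \<in> S \<Longrightarrow> [b, d] \<in> rel (paths one_path) 0 \<Longrightarrow> d \<in> S"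
    using disconnectedE[OF univ_paths] by metis
  obtain b where "b \<in> S" using S by blast
  have step: "int_encode (i + e) \<in> S" if "int_encode i \<in> S" "e = 1 \<or> e = - 1" for i e
    by (rule closed[OF that(1)]) (use that(2) in \<open>auto simp: paths_def near_Some_iff one_path_def\<close>)
  have "int_encode i \<in> S" for i
  proof (induction i rule: int_induct[of _ "int_decode b"])
    case base
    show ?case using \<open>b \<in> S\<close> by simp
  next
    case (step1 i)
    then show ?case using step[of i 1] by simp
  next
    case (step2 i)
    then show ?case using step[of i "- 1"] by simp
  qed
  then have "int_encode (int_decode a) \<in> S" .
  with \<open>a \<notin> S\<close> show False by simp
qed

theorem theorem45:
  "\<not> safe_for TYPE(nat) {constancy} {unary_inclusion}"
proof
  assume "safe_for TYPE(nat) {constancy} {unary_inclusion}"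
  then obtain \<psi> where \<psi>: "\<psi> \<in> FO_sentences {unary_inclusion} graph_sig"
    and eq: "equivalent TYPE(nat) graph_sig disconnected \<psi>"
    using disconnected_sentence unfolding safe_for_def by blast
  have "true_in (paths two_paths) \<psi>"
    using eq is_model_paths two_paths_disconnected unfolding equivalent_def by blast
  then have "true_in (paths one_path) \<psi>"
    by (rule transfer_sentence[OF path_coords_two_paths path_coords_one_path one_path_transitive \<psi>])
  then show False
    using eq is_model_paths one_path_connected unfolding equivalent_def by blast
qed

end
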